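(* Consider the filtering problem with hidden process $X_t$, observation process $Y_t$, and filtering distribution $P_t(B):=\mathrm{Pr}(X_t\in B\,|\,\mathcal{F}^Y_t)$ for $B\in\mathcal{B}(\mathbb{R})$. Let $(S_t,W_t)$ be a pair process characterizing an abstract particle system, and let $Q_t$ denote the (regular) conditional distribution of $S_t$ given $\mathcal{F}^Y_t$, i.e. $Q_t(B):=\mathrm{Pr}(S_t\in B\,|\,\mathcal{F}^Y_t)$. At any time $t$, under the condition that the particle system described by $(S_t,W_t)$ targets the filtering distribution $P_t$ at time $t$, the following hold. I. The distribution $P_t$ is absolutely continuous with respect to the distribution $Q_t$. In particular, the Radon--Nikodym derivative $dP_t/dQ_t$ exists, and $$\mathbb{E}[W_t\,|\,\mathcal{F}^Y_t,S_t]=\frac{dP_t}{dQ_t}(S_t)\quad\text{a.s.}\qquad( * )$$ II. The random variable $W_t^*:=\frac{dP_t}{dQ_t}(S_t)$ minimizes $\mathbb{E}[W_t^2]$ (as $W_t$ varies) subject to the constraint $( * )$.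
   Context: All processes are real-valued, defined on a filtered probability space $(\Omega,\mathcal{F},\mathbb{P},(\mathcal{F}_t)_{t\ge0})$ satisfying the usual conditions, and progressively measurable. SDEs are in the Itô sense. Filtering problem: $dX_t=f(X_t,t)\,dt+g(X_t,t)\,dB^X_t$ with $X_0\sim P_0$, and $dY_t=h(X_t,t)\,dt+dB^Y_t$ with $Y_0=0$, where $B^X,B^Y$ are independent real Brownian motions, $f,g,h:\mathbb{R}\times\mathbb{R}_{\ge0}\to\mathbb{R}$ are known functions, and $X_0$ is independent of $(B^X,B^Y)$ with distribution $P_0$ having finite second moment. $\mathcal{F}^Y_t:=\sigma(Y_s:0\le s\le t)$. The filtering distribution $P_t$ is the regular conditional distribution of $X_t$ given $\mathcal{F}^Y_t$. Standing assumptions: $f,g$ satisfy the conditions for well-posedness of the SDE (e.g. locally Lipschitz in $x$ uniformly in $t$); and either $g^2\ge\delta>0$ for a constant $\delta$ with $f\in C_b^{1,0}$, $g^2\in C_b^{2,0}$, $h\in C_b^{1,0}$ ($C_b^{\kappa,j}$: bounded continuous functions with bounded partial derivatives up to order $\kappa$ in $x$ and $j$ in $t$), or the linear-Gaussian case $f=ax$, $g=b$, $h=cx$ with $a,b,c\in\mathbb{R}$ and $P_0$ Gaussian. A particle system described by a pair process $(S_t,W_t)$ (particles and importance weights) targets the filtering distribution at time $t$ if and only if $\mathbb{E}[W_t\phi(S_t)\,|\,\mathcal{F}^Y_t]=\mathbb{E}[\phi(X_t)\,|\,\mathcal{F}^Y_t]$ a.s. for every measurable $\phi:\mathbb{R}\to\mathbb{R}$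 with $\mathbb{E}[|\phi(X_t)|]<\infty$. $P_t$ and $Q_t$ are random measures; assertions about them are understood almost surely. *)

theory Defs
  imports "HOL-Probability.Probability"
begin

text \<open>
  Processes have type \<open>real \<Rightarrow> 'a \<Rightarrow> real\<close>; only times \<open>t \<ge> 0\<close> are constrained. Sub-sigma-algebras are
  represented by measures of which only the space and the measurable sets matter.
\<close>

section \<open>Filtrations and processes\<close>

text \<open>The library locale \<open>filtration\<close> would constrain all real indices, including negative ones.\<close>

definition usual_filtration :: "'a measure \<Rightarrow> (real \<Rightarrow> 'a measure) \<Rightarrow> bool" where
  "usual_filtration M F \<longleftrightarrow>
     (\<forall>t\<ge>0. subalgebra M (F t)) \<and>
     (\<forall>s t. 0 \<le> s \<and> s \<le> t \<longrightarrow> sets (F s) \<subseteq> sets (F t)) \<and>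
     complete_measure M \<and>
     null_sets M \<subseteq> sets (F 0) \<and>
     (\<forall>t\<ge>0. sets (F t) = (\<Inter>s\<in>{t<..}. sets (F s)))"

definition progressive :: "(real \<Rightarrow> 'a measure) \<Rightarrow> (real \<Rightarrow> 'a \<Rightarrow> real) \<Rightarrow> bool" where
  "progressive F Z \<longleftrightarrow>
     (\<forall>T\<ge>0. (\<lambda>(s, \<omega>). Z s \<omega>) \<in> borel_measurable (restrict_space borel {0..T} \<Otimes>\<^sub>M F T))"

definition ae_continuous_paths :: "'a measure \<Rightarrow> (real \<Rightarrow> 'a \<Rightarrow> real) \<Rightarrow> bool" where
  "ae_continuous_paths M Z \<longleftrightarrow> (AE \<omega> in M. continuous_on {0..} (\<lambda>t. Z t \<omega>))"

definition observation_sigma :: "'a measure \<Rightarrow> (real \<Rightarrow> 'a \<Rightarrow> real) \<Rightarrow> real \<Rightarrow> 'a measure" where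
  "observation_sigma M Y t =
     sigma (space M) {Y s -` A \<inter> space M | s A. 0 \<le> s \<and> s \<le> t \<and> A \<in> sets borel}"

definition join_sigma :: "'a measure \<Rightarrow> 'a measure \<Rightarrow> ('a \<Rightarrow> real) \<Rightarrow> 'a measure" where
  "join_sigma M G Z = sigma (space M) (sets G \<union> {Z -` A \<inter> space M | A. A \<in> sets borel})"

text \<open>The whole path, as a random element of the product sigma-algebra \<open>path_space\<close>.\<close>

definition path_space :: "(real \<Rightarrow> real) measure" where
  "path_space = Pi\<^sub>M {0..} (\<lambda>_. borel)"

definition sample_path :: "(real \<Rightarrow> 'a \<Rightarrow> real) \<Rightarrow> 'a \<Rightarrow> real \<Rightarrow> real" where
  "sample_path Z \<omega> = (\<lambda>t\<in>{0..}. Z t \<omega>)"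

section \<open>Brownian motion and the Ito integral\<close>

definition brownian_motion :: "'a measure \<Rightarrow> (real \<Rightarrow> 'a measure) \<Rightarrow> (real \<Rightarrow> 'a \<Rightarrow> real) \<Rightarrow> bool" where
  "brownian_motion M F B \<longleftrightarrow>
     progressive F B \<and> ae_continuous_paths M B \<and> (AE \<omega> in M. B 0 \<omega> = 0) \<and>
     (\<forall>s t. 0 \<le> s \<and> s < t \<longrightarrow>
        distributed M lborel (\<lambda>\<omega>. B t \<omega> - B s \<omega>) (\<lambda>x. ennreal (normal_density 0 (sqrt (t - s)) x)) \<and>
        prob_space.indep_set M (sets (F s))
          {(\<lambda>\<omega>. B t \<omega> - B s \<omega>) -` A \<inter> space M | A. A \<in> sets borel})"

text \<open>
  A triple \<open>(n, \<tau>, \<xi>)\<close> stands for the simple integrand that equals \<open>\<xi> i\<close> on \<open>(\<tau> i, \<tau> (i + 1)]\<close>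
  for \<open>i < n\<close>, and vanishes elsewhere.
\<close>

definition simple_integrand ::
  "'a measure \<Rightarrow> (real \<Rightarrow> 'a measure) \<Rightarrow> nat \<Rightarrow> (nat \<Rightarrow> real) \<Rightarrow> (nat \<Rightarrow> 'a \<Rightarrow> real) \<Rightarrow> bool" where
  "simple_integrand M F n \<tau> \<xi> \<longleftrightarrow>
     0 \<le> \<tau> 0 \<and> (\<forall>i<n. \<tau> i \<le> \<tau> (Suc i)) \<and>
     (\<forall>i<n. \<xi> i \<in> borel_measurable (F (\<tau> i))) \<and>
     (\<exists>C. \<forall>i<n. \<forall>\<omega>\<in>space M. \<bar>\<xi> i \<omega>\<bar> \<le> C)"

definition simple_value :: "nat \<Rightarrow> (nat \<Rightarrow> real) \<Rightarrow> (nat \<Rightarrow> 'a \<Rightarrow> real) \<Rightarrow> real \<Rightarrow> 'a \<Rightarrow> real" where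
  "simple_value n \<tau> \<xi> s \<omega> = (\<Sum>i<n. \<xi> i \<omega> * indicator {\<tau> i <.. \<tau> (Suc i)} s)"

definition simple_integral ::
  "(real \<Rightarrow> 'a \<Rightarrow> real) \<Rightarrow> nat \<Rightarrow> (nat \<Rightarrow> real) \<Rightarrow> (nat \<Rightarrow> 'a \<Rightarrow> real) \<Rightarrow> real \<Rightarrow> 'a \<Rightarrow> real" where
  "simple_integral B n \<tau> \<xi> t \<omega> =
     (\<Sum>i<n. \<xi> i \<omega> * (B (min (\<tau> (Suc i)) t) \<omega> - B (min (\<tau> i) t) \<omega>))"

definition vanishes_in_probability :: "'a measure \<Rightarrow> (nat \<Rightarrow> 'a \<Rightarrow> ennreal) \<Rightarrow> bool" where
  "vanishes_in_probability M Z \<longleftrightarrow>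
     (\<forall>\<epsilon>>0. (\<lambda>k. measure M {\<omega>\<in>space M. \<epsilon> < Z k \<omega>}) \<longlonglongrightarrow> 0)"

text \<open>
  \<open>I\<close> is (a version of) the continuous process \<open>\<integral>\<^sub>0\<^sup>t G dB\<close>. By the extension of the Ito
  isometry to convergence in probability, it is determined up to indistinguishability and does not
  depend on the approximating sequence. Pathwise square integrability on bounded intervals is all
  that is required of the integrand \<open>G\<close>.
\<close>

definition has_ito_integral ::
  "'a measure \<Rightarrow> (real \<Rightarrow> 'a measure) \<Rightarrow> (real \<Rightarrow> 'a \<Rightarrow> real) \<Rightarrow> (real \<Rightarrow> 'a \<Rightarrow> real) \<Rightarrow>
     (real \<Rightarrow> 'a \<Rightarrow> real) \<Rightarrow> bool" where
  "has_ito_integral M F B G I \<longleftrightarrow>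
     progressive F G \<and> (AE \<omega> in M. \<forall>t\<ge>0. set_integrable lborel {0..t} (\<lambda>s. (G s \<omega>)\<^sup>2)) \<and>
     progressive F I \<and> ae_continuous_paths M I \<and>
     (\<exists>n \<tau> \<xi>. (\<forall>k. simple_integrand M F (n k) (\<tau> k) (\<xi> k)) \<and>
       (\<forall>t\<ge>0.
          vanishes_in_probability M (\<lambda>k \<omega>.
            \<integral>\<^sup>+s\<in>{0..t}. ennreal ((simple_value (n k) (\<tau> k) (\<xi> k) s \<omega> - G s \<omega>)\<^sup>2) \<partial>lborel) \<and>
          vanishes_in_probability M (\<lambda>k \<omega>.
            ennreal \<bar>simple_integral B (n k) (\<tau> k) (\<xi> k) t \<omega> - I t \<omega>\<bar>)))"

section \<open>Stochastic differential equations\<close>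

definition sde_solution ::
  "'a measure \<Rightarrow> (real \<Rightarrow> 'a measure) \<Rightarrow> (real \<Rightarrow> real \<Rightarrow> real) \<Rightarrow> (real \<Rightarrow> real \<Rightarrow> real) \<Rightarrow>
     (real \<Rightarrow> 'a \<Rightarrow> real) \<Rightarrow> ('a \<Rightarrow> real) \<Rightarrow> (real \<Rightarrow> 'a \<Rightarrow> real) \<Rightarrow> bool" where
  "sde_solution M F f g B x0 X \<longleftrightarrow>
     progressive F X \<and> ae_continuous_paths M X \<and> (AE \<omega> in M. X 0 \<omega> = x0 \<omega>) \<and>
     (AE \<omega> in M. \<forall>t\<ge>0. set_integrable lborel {0..t} (\<lambda>s. f (X s \<omega>) s)) \<and>
     (\<exists>I. has_ito_integral M F B (\<lambda>s \<omega>. g (X s \<omega>) s) I \<and>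
       (AE \<omega> in M. \<forall>t\<ge>0. X t \<omega> = x0 \<omega> + (LINT s:{0..t}|lborel. f (X s \<omega>) s) + I t \<omega>))"

definition sde_well_posed ::
  "'a measure \<Rightarrow> (real \<Rightarrow> 'a measure) \<Rightarrow> (real \<Rightarrow> real \<Rightarrow> real) \<Rightarrow> (real \<Rightarrow> real \<Rightarrow> real) \<Rightarrow>
     (real \<Rightarrow> 'a \<Rightarrow> real) \<Rightarrow> ('a \<Rightarrow> real) \<Rightarrow> bool" where
  "sde_well_posed M F f g B x0 \<longleftrightarrow>
     (\<exists>X. sde_solution M F f g B x0 X) \<and>
     (\<forall>X X'. sde_solution M F f g B x0 X \<and> sde_solution M F f g B x0 X' \<longrightarrow>
        (AE \<omega> in M. \<forall>t\<ge>0. X t \<omega> = X' t \<omega>))"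

text \<open>
  The class \<open>C\<^sub>b\<^sup>\<kappa>\<^sup>,\<^sup>0\<close> on \<open>\<real> \<times> \<real>\<^sub>\<ge>\<^sub>0\<close>, with \<open>D i\<close> the \<open>i\<close>-th partial derivative in the first argument.
\<close>

definition Cb :: "nat \<Rightarrow> (real \<Rightarrow> real \<Rightarrow> real) \<Rightarrow> bool" where
  "Cb \<kappa> u \<longleftrightarrow>
     continuous_on (UNIV \<times> {0..}) (\<lambda>(x, t). u x t) \<and>
     (\<exists>D :: nat \<Rightarrow> real \<Rightarrow> real \<Rightarrow> real.
        D 0 = u \<and>
        (\<forall>i<\<kappa>. \<forall>x. \<forall>t\<ge>0. ((\<lambda>y. D i y t) has_real_derivative D (Suc i) x t) (at x)) \<and>
        (\<forall>i\<le>\<kappa>. \<exists>C. \<forall>x. \<forall>t\<ge>0. \<bar>D i x t\<bar> \<le> C))"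

text \<open>Point masses count as (degenerate) Gaussian distributions.\<close>

definition gaussian :: "real measure \<Rightarrow> bool" where
  "gaussian P \<longleftrightarrow>
     (\<exists>m. P = return borel m \<or> (\<exists>\<sigma>>0. P = density lborel (\<lambda>x. ennreal (normal_density m \<sigma> x))))"

section \<open>The filtering problem\<close>

locale filtering_problem = prob_space M
  for M :: "'a measure" +
  fixes F :: "real \<Rightarrow> 'a measure"
    and f g h :: "real \<Rightarrow> real \<Rightarrow> real"
    and P0 :: "real measure"
    and BX BY X Y :: "real \<Rightarrow> 'a \<Rightarrow> real"
  assumes usual: "usual_filtration M F"
    and BX: "brownian_motion M F BX"
    and BY: "brownian_motion M F BY"
    and BX_BY_indep: "indep_var path_space (sample_path BX) path_space (sample_path BY)"
    and X0_indep:
      "indep_set (sets (vimage_algebra (space M) (X 0) borel))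
         (sets (vimage_algebra (space M) (\<lambda>\<omega>. (sample_path BX \<omega>, sample_path BY \<omega>)) (path_space \<Otimes>\<^sub>M path_space)))"
    and X0_distr: "distr M borel (X 0) = P0"
    and P0_moment: "integrable P0 (\<lambda>x. x\<^sup>2)"
    and X_sde: "sde_solution M F f g BX (X 0) X"
    and well_posed: "sde_well_posed M F f g BX (X 0)"
    and Y_progressive: "progressive F Y"
    and Y_0: "AE \<omega> in M. Y 0 \<omega> = 0"
    and drift_Y: "AE \<omega> in M. \<forall>t\<ge>0. set_integrable lborel {0..t} (\<lambda>s. h (X s \<omega>) s)"
    and Y_eq: "AE \<omega> in M. \<forall>t\<ge>0. Y t \<omega> = (LINT s:{0..t}|lborel. h (X s \<omega>) s) + BY t \<omega>"
    and coefficients: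
      "((\<exists>\<delta>>0. \<forall>x. \<forall>t\<ge>0. (g x t)\<^sup>2 \<ge> \<delta>) \<and> Cb 1 f \<and> Cb 2 (\<lambda>x t. (g x t)\<^sup>2) \<and> Cb 1 h) \<or>
       ((\<exists>a b c. \<forall>x. \<forall>t\<ge>0. f x t = a * x \<and> g x t = b \<and> h x t = c * x) \<and> gaussian P0)"

section \<open>Conditional distributions, targeting and Radon--Nikodym derivatives\<close>

definition regular_cond_distr ::
  "'a measure \<Rightarrow> 'a measure \<Rightarrow> ('a \<Rightarrow> real) \<Rightarrow> ('a \<Rightarrow> real measure) \<Rightarrow> bool" where
  "regular_cond_distr M G Z K \<longleftrightarrow>
     K \<in> G \<rightarrow>\<^sub>M prob_algebra borel \<and>
     (\<forall>B\<in>sets borel. AE \<omega> in M. measure (K \<omega>) B = real_cond_exp M G (\<lambda>\<omega>. indicator B (Z \<omega>)) \<omega>)"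

text \<open>
  \<open>real_cond_exp\<close> is total, so the integrability implicit in writing \<open>E[W \<phi>(S) | G]\<close> is explicit.
  The arguments \<open>X\<close>, \<open>S\<close>, \<open>W\<close> are the values of the processes at the time in question.
\<close>

definition targets ::
  "'a measure \<Rightarrow> 'a measure \<Rightarrow> ('a \<Rightarrow> real) \<Rightarrow> ('a \<Rightarrow> real) \<Rightarrow> ('a \<Rightarrow> real) \<Rightarrow> bool" where
  "targets M G X S W \<longleftrightarrow>
     (\<forall>\<phi>\<in>borel_measurable borel. integrable M (\<lambda>\<omega>. \<phi> (X \<omega>)) \<longrightarrow>
        integrable M (\<lambda>\<omega>. W \<omega> * \<phi> (S \<omega>)) \<and>
        (AE \<omega> in M. real_cond_exp M G (\<lambda>\<omega>. W \<omega> * \<phi> (S \<omega>)) \<omega> =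
                     real_cond_exp M G (\<lambda>\<omega>. \<phi> (X \<omega>)) \<omega>))"

text \<open>
  \<open>RN_deriv (Q \<omega>) (P \<omega>)\<close> is chosen separately for each \<open>\<omega>\<close>, up to a \<open>Q \<omega>\<close>-null set, so plugging a
  random point into it need not yield a random variable. A version of \<open>dP/dQ\<close> is
  therefore a jointly measurable function that agrees with it for almost every \<open>\<omega>\<close>;
  this is meaningful when \<open>P \<omega>\<close> is absolutely continuous w.r.t. \<open>Q \<omega>\<close> a.s.
\<close>

definition RN_version ::
  "'a measure \<Rightarrow> 'a measure \<Rightarrow> ('a \<Rightarrow> real measure) \<Rightarrow> ('a \<Rightarrow> real measure) \<Rightarrow>
     ('a \<Rightarrow> real \<Rightarrow> ennreal) \<Rightarrow> bool" where
  "RN_version M G Q P D \<longleftrightarrow>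
     (\<lambda>(\<omega>, x). D \<omega> x) \<in> borel_measurable (G \<Otimes>\<^sub>M borel) \<and>
     (AE \<omega> in M. AE x in Q \<omega>. D \<omega> x = RN_deriv (Q \<omega>) (P \<omega>) x)"

text \<open>
  The constraint \<open>E[V | H] = R\<close> a.s.; \<open>G\<close> is the sigma-algebra to which the weights are adapted.
\<close>

definition admissible_weight ::
  "'a measure \<Rightarrow> 'a measure \<Rightarrow> 'a measure \<Rightarrow> ('a \<Rightarrow> real) \<Rightarrow> ('a \<Rightarrow> real) \<Rightarrow> bool" where
  "admissible_weight M G H R V \<longleftrightarrow>
     V \<in> borel_measurable G \<and> integrable M V \<and> (AE \<omega> in M. real_cond_exp M H V \<omega> = R \<omega>)"

end

theory Submission
  imports Defs
begin

text \<open>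
  Write \<open>G\<close> for the observation sigma-algebra \<open>\<F>\<^sup>Y\<^sub>t\<close>. All assertions are statements about the two
  joint laws of \<open>(\<omega>, X\<^sub>t \<omega>)\<close> and \<open>(\<omega>, S\<^sub>t \<omega>)\<close> on \<open>G \<Otimes> borel\<close>. Tested on indicator functions, the
  targeting condition says that the first law has mass \<open>E[W\<^sub>t; (\<omega>, S\<^sub>t \<omega>) \<in> C]\<close> on every measurable
  rectangle \<open>C\<close>, hence on every measurable \<open>C\<close> (\<open>targets_joint_law\<close>). This mass is zero as soon as
  \<open>(\<omega>, S\<^sub>t \<omega>) \<in> C\<close> has probability zero, whatever the sign of \<open>W\<^sub>t\<close>. The theorem of Radon and Nikodym
  on the product space therefore yields a density \<open>v (\<omega>, x)\<close> that is nonnegative and jointly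
  measurable from the outset (\<open>targets_joint_density\<close>).

  This single function answers both questions. Events of the sigma-algebra generated by \<open>G\<close> and
  \<open>S\<^sub>t\<close> are those of the form \<open>(\<omega>, S\<^sub>t \<omega>) \<in> C\<close>, so \<open>v (\<omega>, S\<^sub>t \<omega>)\<close> is the conditional
  expectation of \<open>W\<^sub>t\<close> (\<open>targets_cond_exp_weight\<close>). Disintegrating both laws over \<open>G\<close>, with kernels
  \<open>P\<close> and \<open>Q\<close>, shows that \<open>v (\<omega>, \<cdot>)\<close> is the density of \<open>P \<omega>\<close> with respect to \<open>Q \<omega>\<close> for almost
  every \<open>\<omega>\<close> (\<open>AE_regular_cond_distr_eq_density\<close>). Two versions of \<open>dP/dQ\<close> differ, for almost every
  \<open>\<omega>\<close>, on a \<open>Q \<omega>\<close>-null set only, and the random point \<open>S\<^sub>t\<close> almost surely avoids it because \<open>Q\<close> is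
  its conditional law (\<open>AE_eq_at_random_point\<close>).

  Part II is Jensen's inequality: conditional expectation does not increase the second moment, and
  \<open>W\<^sup>*\<close>, a function of the observations and of \<open>S\<^sub>t\<close>, is its own conditional expectation.
\<close>

section \<open>Sigma-algebras\<close>

lemma subalgebra_observation_sigma:
  assumes "\<And>s. 0 \<le> s \<Longrightarrow> s \<le> t \<Longrightarrow> Y s \<in> borel_measurable N" "space N = space M"
  shows "subalgebra N (observation_sigma M Y t)"
  unfolding subalgebra_def
proof
  show "space (observation_sigma M Y t) = space N"
    using assms(2) by (simp add: observation_sigma_def space_measure_of_conv)
  show "sets (observation_sigma M Y t) \<subseteq> sets N"
    unfolding observation_sigma_def assms(2)[symmetric]
    by (subst sets_measure_of) (auto intro!: sets.sigma_sets_subset measurable_sets assms(1))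
qed

text \<open>
  The generators of the join are the preimages of the rectangles \<open>A \<times> UNIV\<close> and \<open>UNIV \<times> B\<close>. Hence the
  join consists of the preimages of the sets of the product sigma-algebra, and identities about the
  join become identities between measures on the product.
\<close>

lemma sets_join_sigma:
  assumes G: "space G = space M"
  shows "sets (join_sigma M G Z) =
    sets (vimage_algebra (space M) (\<lambda>\<omega>. (\<omega>, Z \<omega>)) (G \<Otimes>\<^sub>M borel))" (is "_ = sets ?V")
proof -
  let ?E = "sets G \<union> {Z -` A \<inter> space M | A. A \<in> sets borel}"
  have E: "?E \<subseteq> Pow (space M)"
    using sets.sets_into_space[of _ G] G by auto
  have J: "sets (join_sigma M G Z) = sigma_sets (space M) ?E"
    unfolding join_sigma_def using E by (rule sets_measure_of)
  have V: "(\<lambda>\<omega>. (\<omega>, Z \<omega>)) \<in> ?V \<rightarrow>\<^sub>M G \<Otimes>\<^sub>M borel"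
    by (rule measurable_vimage_algebra1) (auto simp: space_pair_measure G)
  have "?E \<subseteq> sets ?V"
  proof
    fix A assume "A \<in> ?E"
    then show "A \<in> sets ?V"
    proof
      assume A: "A \<in> sets G"
      have "(\<lambda>\<omega>. \<omega>) \<in> ?V \<rightarrow>\<^sub>M G"
        using measurable_comp[OF V measurable_fst] by (simp add: comp_def)
      from measurable_sets[OF this A] sets.sets_into_space[OF A] show ?thesis
        by (simp add: G Int_absorb2)
    next
      assume "A \<in> {Z -` A \<inter> space M | A. A \<in> sets borel}"
      then obtain B where B: "B \<in> sets borel" "A = Z -` B \<inter> space M" by auto
      have "Z \<in> ?V \<rightarrow>\<^sub>M borel"
        using measurable_comp[OF V measurable_snd] by (simp add: comp_def)
      from measurable_sets[OF this B(1)] show ?thesis by (simp add: B)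
    qed
  qed
  then have 1: "sigma_sets (space M) ?E \<subseteq> sets ?V"
    using sets.sigma_sets_subset[of ?E ?V] by simp
  have id: "(\<lambda>\<omega>. \<omega>) \<in> join_sigma M G Z \<rightarrow>\<^sub>M G"
    using G sets.sets_into_space[of _ G]
    by (intro measurableI) (auto simp: J space_measure_of_conv join_sigma_def Int_absorb2)
  have Z: "Z \<in> join_sigma M G Z \<rightarrow>\<^sub>M borel"
    by (intro measurableI) (auto simp: J, auto simp: space_measure_of_conv join_sigma_def)
  have "sets ?V \<subseteq> sets (join_sigma M G Z)"
    using measurable_Pair[OF id Z]
    by (intro sets_image_in_sets) (auto simp: join_sigma_def space_measure_of_conv)
  with 1 J show ?thesis by blast
qed

lemma measurable_join_sigma:
  assumes "space G = space M"
  shows "(\<lambda>\<omega>. (\<omega>, Z \<omega>)) \<in> join_sigma M G Z \<rightarrow>\<^sub>M G \<Otimes>\<^sub>M borel"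
proof -
  have "(\<lambda>\<omega>. (\<omega>, Z \<omega>)) \<in> vimage_algebra (space M) (\<lambda>\<omega>. (\<omega>, Z \<omega>)) (G \<Otimes>\<^sub>M borel) \<rightarrow>\<^sub>M G \<Otimes>\<^sub>M borel"
    by (rule measurable_vimage_algebra1) (auto simp: space_pair_measure assms)
  then show ?thesis
    using measurable_cong_sets[OF sets_join_sigma[OF assms] refl] by blast
qed

lemma sets_join_sigmaE:
  assumes "A \<in> sets (join_sigma M G Z)" "space G = space M"
  obtains C where "C \<in> sets (G \<Otimes>\<^sub>M borel)" "A = (\<lambda>\<omega>. (\<omega>, Z \<omega>)) -` C \<inter> space M"
proof -
  have "(\<lambda>\<omega>. (\<omega>, Z \<omega>)) \<in> space M \<rightarrow> space (G \<Otimes>\<^sub>M borel)"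
    by (auto simp: space_pair_measure assms(2))
  from sets_vimage_algebra2[OF this] assms that show ?thesis
    unfolding sets_join_sigma[OF assms(2)] by auto
qed

lemma measurable_pair_subalgebra:
  assumes "subalgebra M G" "Z \<in> borel_measurable M"
  shows "(\<lambda>\<omega>. (\<omega>, Z \<omega>)) \<in> M \<rightarrow>\<^sub>M G \<Otimes>\<^sub>M borel"
  using measurable_from_subalg[OF assms(1) measurable_ident] assms(2)
  by (intro measurable_Pair) (auto simp: id_def)

lemma subalgebra_join_sigma:
  assumes G: "subalgebra N G" "space N = space M" and Z: "Z \<in> borel_measurable N"
  shows "subalgebra N (join_sigma M G Z)"
proof -
  have [simp]: "space G = space M" using G by (simp add: subalgebra_def)
  have "sets (join_sigma M G Z) \<subseteq> sets N"
  proof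
    fix A assume "A \<in> sets (join_sigma M G Z)"
    then obtain C where "C \<in> sets (G \<Otimes>\<^sub>M borel)" "A = (\<lambda>\<omega>. (\<omega>, Z \<omega>)) -` C \<inter> space N"
      using G by (auto elim: sets_join_sigmaE)
    then show "A \<in> sets N"
      using measurable_sets[OF measurable_pair_subalgebra[OF G(1) Z]] by simp
  qed
  then show ?thesis
    using G by (simp add: subalgebra_def join_sigma_def space_measure_of_conv)
qed

lemma progressive_adapted:
  assumes "progressive F Z" "0 \<le> t"
  shows "Z t \<in> borel_measurable (F t)"
proof -
  have Z: "(\<lambda>(s, \<omega>). Z s \<omega>) \<in> borel_measurable (restrict_space borel {0..t} \<Otimes>\<^sub>M F t)"
    using assms by (auto simp: progressive_def)
  have t: "(\<lambda>\<omega>. (t, \<omega>)) \<in> F t \<rightarrow>\<^sub>M restrict_space borel {0..t} \<Otimes>\<^sub>M F t"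
    using assms(2) by (intro measurable_Pair1') (auto simp: space_restrict_space)
  show ?thesis
    using measurable_compose[OF t Z] by (simp only: split_conv)
qed

section \<open>Disintegration of joint laws\<close>

text \<open>
  The defining property of conditional expectation, integrated over \<open>A \<in> G\<close>; this is the
  disintegration of the joint law on rectangles.
\<close>

lemma (in prob_space) regular_cond_distr_emeasure:
  assumes G: "subalgebra M G" and Z[measurable]: "Z \<in> borel_measurable M"
    and K: "regular_cond_distr M G Z K"
    and A: "A \<in> sets G" and B: "B \<in> sets borel"
  shows "emeasure M {\<omega>\<in>A. Z \<omega> \<in> B} = (\<integral>\<^sup>+\<omega>. emeasure (K \<omega>) B * indicator A \<omega> \<partial>M)"
proof -
  interpret G: finite_measure_subalgebra M G
    by unfold_locales (rule G)
  note [measurable] = B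
  have AM[measurable]: "A \<in> sets M" using A G by (auto simp: subalgebra_def)
  have K_kernel: "K \<in> G \<rightarrow>\<^sub>M prob_algebra borel"
    and K_cond: "AE \<omega> in M. measure (K \<omega>) B = real_cond_exp M G (\<lambda>\<omega>. indicator B (Z \<omega>)) \<omega>"
    using K B by (auto simp: regular_cond_distr_def)
  have K_prob: "prob_space (K \<omega>)" if "\<omega> \<in> space M" for \<omega>
    using measurable_space[OF K_kernel, of \<omega>] that G by (auto simp: space_prob_algebra subalgebra_def)
  have KM: "K \<in> M \<rightarrow>\<^sub>M prob_algebra borel"
    by (rule measurable_from_subalg[OF G K_kernel])
  have meas[measurable]: "(\<lambda>\<omega>. measure (K \<omega>) B) \<in> borel_measurable M"
    by (rule measure_measurable_prob_algebra2[OF _ KM]) simp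
  have ae: "AE \<omega> in M. \<omega> \<in> A \<longrightarrow>
      real_cond_exp M G (\<lambda>\<omega>. indicator B (Z \<omega>)) \<omega> = measure (K \<omega>) B"
    using K_cond by eventually_elim simp
  have int: "integrable M (\<lambda>\<omega>. indicator B (Z \<omega>) :: real)"
    by (rule integrable_const_bound[of _ 1]) auto
  have "measure M {\<omega>\<in>A. Z \<omega> \<in> B} = (\<integral>\<omega>\<in>A. indicator B (Z \<omega>) \<partial>M)"
  proof -
    have eq: "{\<omega>\<in>A. Z \<omega> \<in> B} = {\<omega>\<in>space M. \<omega> \<in> A \<and> Z \<omega> \<in> B}"
      using sets.sets_into_space[OF AM] by auto
    have "(\<integral>\<omega>\<in>A. indicator B (Z \<omega>) \<partial>M) = (\<integral>\<omega>. indicator {\<omega>\<in>space M. \<omega> \<in> A \<and> Z \<omega> \<in> B} \<omega> \<partial>M :: real)"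
      unfolding set_lebesgue_integral_def
      by (intro Bochner_Integration.integral_cong) (auto simp: indicator_def)
    then show ?thesis unfolding eq by simp
  qed
  also have "\<dots> = (\<integral>\<omega>\<in>A. real_cond_exp M G (\<lambda>\<omega>. indicator B (Z \<omega>)) \<omega> \<partial>M)"
    by (rule G.real_cond_exp_intA[OF int A])
  also have "\<dots> = (\<integral>\<omega>\<in>A. measure (K \<omega>) B \<partial>M)"
    using ae by (intro set_lebesgue_integral_cong_AE) auto
  finally have eq: "measure M {\<omega>\<in>A. Z \<omega> \<in> B} = (\<integral>\<omega>. measure (K \<omega>) B * indicator A \<omega> \<partial>M)"
    by (simp add: set_lebesgue_integral_def mult.commute)
  have int2: "integrable M (\<lambda>\<omega>. measure (K \<omega>) B * indicator A \<omega>)"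
    using K_prob
    by (intro integrable_const_bound[of _ 1] AE_I2) (auto simp: prob_space.prob_le_1 indicator_def)
  have "(\<integral>\<^sup>+\<omega>. emeasure (K \<omega>) B * indicator A \<omega> \<partial>M)
      = (\<integral>\<^sup>+\<omega>. ennreal (measure (K \<omega>) B * indicator A \<omega>) \<partial>M)"
    using K_prob
    by (intro nn_integral_cong)
      (auto simp: indicator_def finite_measure.emeasure_eq_measure prob_space.finite_measure)
  also have "\<dots> = ennreal (measure M {\<omega>\<in>A. Z \<omega> \<in> B})"
    unfolding eq by (intro nn_integral_eq_integral int2) (auto simp: indicator_def)
  finally show ?thesis by (simp add: emeasure_eq_measure)
qed

text \<open>
  The left side integrates \<open>u\<close> against the law of \<open>(\<omega>, Z \<omega>)\<close>, the right side against the composition of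
  \<open>M\<close> with the kernel that sends \<open>\<omega>\<close> to the image of \<open>K \<omega>\<close> under \<open>x \<mapsto> (\<omega>, x)\<close>. These probability
  measures agree on rectangles, which generate the product sigma-algebra and are closed under
  intersection.
\<close>

lemma (in prob_space) nn_integral_disintegrate:
  assumes G: "subalgebra M G" and Z[measurable]: "Z \<in> borel_measurable M"
    and K: "regular_cond_distr M G Z K"
    and u: "u \<in> borel_measurable (G \<Otimes>\<^sub>M borel)"
  shows "(\<integral>\<^sup>+\<omega>. u (\<omega>, Z \<omega>) \<partial>M) = (\<integral>\<^sup>+\<omega>. \<integral>\<^sup>+x. u (\<omega>, x) \<partial>K \<omega> \<partial>M)"
proof -
  have spG: "space G = space M" using G by (simp add: subalgebra_def)
  have KG: "K \<in> G \<rightarrow>\<^sub>M subprob_algebra borel"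
    using K by (auto simp: regular_cond_distr_def intro: measurable_prob_algebraD)
  have KM: "K \<in> M \<rightarrow>\<^sub>M subprob_algebra borel"
    by (rule measurable_from_subalg[OF G KG])
  have pair: "(\<lambda>\<omega>. (\<omega>, Z \<omega>)) \<in> M \<rightarrow>\<^sub>M G \<Otimes>\<^sub>M borel"
    by (rule measurable_pair_subalgebra[OF G Z])
  define L where "L \<omega> = distr (K \<omega>) (G \<Otimes>\<^sub>M borel) (Pair \<omega>)" for \<omega>
  have "(\<lambda>\<omega>. distr (K \<omega>) (G \<Otimes>\<^sub>M borel) (Pair \<omega>)) \<in> G \<rightarrow>\<^sub>M subprob_algebra (G \<Otimes>\<^sub>M borel)"
    by (rule measurable_distr2[OF _ KG]) simp
  then have LM: "L \<in> M \<rightarrow>\<^sub>M subprob_algebra (G \<Otimes>\<^sub>M borel)"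
    unfolding L_def[abs_def] by (rule measurable_from_subalg[OF G])
  have setsK: "sets (K \<omega>) = sets borel" if "\<omega> \<in> space M" for \<omega>
    using measurable_space[OF KM that] by (simp add: space_subprob_algebra)
  have Pair[measurable]: "Pair \<omega> \<in> K \<omega> \<rightarrow>\<^sub>M G \<Otimes>\<^sub>M borel" if "\<omega> \<in> space M" for \<omega>
    using measurable_Pair1'[of \<omega> G borel] that setsK[OF that]
    by (simp add: spG cong: measurable_cong_sets)
  have "distr M (G \<Otimes>\<^sub>M borel) (\<lambda>\<omega>. (\<omega>, Z \<omega>)) = M \<bind> L"
  proof (rule measure_eqI_generator_eq[OF Int_stable_pair_measure_generator])
    show "{a \<times> b | a b. a \<in> sets G \<and> b \<in> sets borel} \<subseteq> Pow (space G \<times> space (borel :: real measure))"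
      using sets.sets_into_space by auto
    show "sets (distr M (G \<Otimes>\<^sub>M borel) (\<lambda>\<omega>. (\<omega>, Z \<omega>))) =
      sigma_sets (space G \<times> space borel) {a \<times> b | a b. a \<in> sets G \<and> b \<in> sets borel}"
      by (simp add: sets_pair_measure)
    show "sets (M \<bind> L) =
      sigma_sets (space G \<times> space borel) {a \<times> b | a b. a \<in> sets G \<and> b \<in> sets borel}"
      using sets_bind[OF sets_kernel[OF LM] not_empty] by (simp add: sets_pair_measure)
    show "range (\<lambda>i::nat. space G \<times> space borel) \<subseteq> {a \<times> b | a b. a \<in> sets G \<and> b \<in> sets (borel :: real measure)}"
      using sets.top[of G] sets.top[of borel] by blast
    show "(\<Union>i::nat. space G \<times> space (borel :: real measure)) = space G \<times> space borel" by simp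
    interpret D: prob_space "distr M (G \<Otimes>\<^sub>M borel) (\<lambda>\<omega>. (\<omega>, Z \<omega>))"
      by (rule prob_space_distr[OF pair])
    show "emeasure (distr M (G \<Otimes>\<^sub>M borel) (\<lambda>\<omega>. (\<omega>, Z \<omega>))) (space G \<times> space borel) \<noteq> \<infinity>"
      by simp
    fix C assume "C \<in> {a \<times> b | a b. a \<in> sets G \<and> b \<in> sets (borel :: real measure)}"
    then obtain A B where C: "C = A \<times> B" and A: "A \<in> sets G" and B: "B \<in> sets borel" by auto
    have sub: "A \<subseteq> space M" using sets.sets_into_space[OF A] spG by simp
    have "emeasure (distr M (G \<Otimes>\<^sub>M borel) (\<lambda>\<omega>. (\<omega>, Z \<omega>))) C = emeasure M {\<omega>\<in>A. Z \<omega> \<in> B}"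
      using A B sub unfolding C
      by (subst emeasure_distr[OF pair]) (auto intro!: arg_cong[of _ _ "emeasure M"])
    also have "\<dots> = (\<integral>\<^sup>+\<omega>. emeasure (K \<omega>) B * indicator A \<omega> \<partial>M)"
      by (rule regular_cond_distr_emeasure[OF G Z K A B])
    also have "\<dots> = (\<integral>\<^sup>+\<omega>. emeasure (L \<omega>) C \<partial>M)"
    proof (rule nn_integral_cong)
      fix \<omega> assume w: "\<omega> \<in> space M"
      have "emeasure (L \<omega>) C = emeasure (K \<omega>) (Pair \<omega> -` C \<inter> space (K \<omega>))"
        unfolding L_def using A B C by (intro emeasure_distr Pair[OF w]) auto
      also have "Pair \<omega> -` C \<inter> space (K \<omega>) = (if \<omega> \<in> A then B else {})"
        using sets_eq_imp_space_eq[OF setsK[OF w]] by (auto simp: C)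
      finally show "emeasure (K \<omega>) B * indicator A \<omega> = emeasure (L \<omega>) C"
        by (simp add: indicator_def)
    qed
    also have "\<dots> = emeasure (M \<bind> L) C"
      using A B C by (intro emeasure_bind[OF not_empty LM, symmetric]) auto
    finally show "emeasure (distr M (G \<Otimes>\<^sub>M borel) (\<lambda>\<omega>. (\<omega>, Z \<omega>))) C = emeasure (M \<bind> L) C" .
  qed
  then have "(\<integral>\<^sup>+p. u p \<partial>distr M (G \<Otimes>\<^sub>M borel) (\<lambda>\<omega>. (\<omega>, Z \<omega>))) = (\<integral>\<^sup>+\<omega>. \<integral>\<^sup>+p. u p \<partial>L \<omega> \<partial>M)"
    using nn_integral_bind[OF u LM] by simp
  then show ?thesis
    using u by (simp add: nn_integral_distr[OF pair] L_def)
      (simp add: nn_integral_distr[OF Pair] cong: nn_integral_cong)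
qed

section \<open>Kernels with a jointly measurable density\<close>

text \<open>
  Countability of the family of rays is the point: an identity that holds almost surely for each
  fixed Borel set can be required of all rational rays at once, and then extends to all Borel sets
  outside a single null set.
\<close>

lemma real_measure_eqI_rational_rays:
  fixes P Q :: "real measure"
  assumes sets: "sets P = sets borel" "sets Q = sets borel" and fin: "finite_measure P"
    and eq: "\<And>q::rat. emeasure P {of_rat q<..} = emeasure Q {of_rat q<..}"
  shows "P = Q"
proof (rule measure_eqI_generator_eq_countable)
  let ?E = "range (\<lambda>q::rat. {real_of_rat q<..})"
  have "{x<..} \<in> sets (sigma UNIV ?E)" for x :: real
  proof -
    have "{x<..} = (\<Union>q\<in>{q. x < real_of_rat q}. {of_rat q<..})"
      using of_rat_dense by fastforce
    also have "\<dots> \<in> sets (sigma UNIV ?E)"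
      by (intro sets.countable_UN') auto
    finally show ?thesis .
  qed
  then have borel: "borel = sigma UNIV ?E"
    by (intro borel_eq_sigmaI1[OF borel_Ioi]) auto
  then have "sets (borel :: real measure) = sigma_sets UNIV ?E"
    by (metis sets_measure_of top_greatest Pow_UNIV)
  then show "sets P = sigma_sets UNIV ?E" "sets Q = sigma_sets UNIV ?E"
    using sets by auto
  have "{real_of_rat a<..} \<inter> {of_rat b<..} = {of_rat (max a b)<..}" for a b
    by (auto simp: max_def) (meson le_less_trans of_rat_less_eq not_le less_imp_le)+
  then show "Int_stable ?E"
    by (auto simp: Int_stable_def)
  show "\<Union>?E = UNIV"
  proof -
    have "x \<in> \<Union>?E" for x
    proof -
      obtain q where "real_of_rat q < x" using of_rat_dense[of "x - 1" x] by auto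
      then show ?thesis by blast
    qed
    then show ?thesis by blast
  qed
  show "emeasure P a \<noteq> \<infinity>" for a
    using finite_measure.emeasure_finite[OF fin] by simp
qed (use eq in auto)

text \<open>
  For \<open>A \<in> G\<close> and a Borel set \<open>B\<close>, disintegrating the mass of \<open>A \<times> B\<close> under both joint laws gives
  \<open>\<integral>\<^sub>A P \<omega> B dM = \<integral>\<^sub>A \<integral>\<^sub>B v (\<omega>, x) Q \<omega> (dx) dM\<close>. Both inner quantities are \<open>G\<close>-measurable in \<open>\<omega>\<close>, and \<open>A\<close>
  is arbitrary, so they agree almost surely for each \<open>B\<close>; rational rays then suffice.
\<close>

lemma (in prob_space) AE_regular_cond_distr_eq_density:
  assumes G: "subalgebra M G"
    and X[measurable]: "X \<in> borel_measurable M" and S[measurable]: "S \<in> borel_measurable M"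
    and P: "regular_cond_distr M G X P" and Q: "regular_cond_distr M G S Q"
    and v[measurable]: "v \<in> borel_measurable (G \<Otimes>\<^sub>M borel)"
    and dens: "density (distr M (G \<Otimes>\<^sub>M borel) (\<lambda>\<omega>. (\<omega>, S \<omega>))) v =
      distr M (G \<Otimes>\<^sub>M borel) (\<lambda>\<omega>. (\<omega>, X \<omega>))"
  shows "AE \<omega> in M. P \<omega> = density (Q \<omega>) (\<lambda>x. v (\<omega>, x))"
proof -
  let ?MG = "restr_to_subalg M G"
  interpret MG: finite_measure ?MG
    by (rule finite_measure_restr_to_subalg[OF G finite_measure_axioms])
  have spG: "space G = space M" using G by (simp add: subalgebra_def)
  have PG: "P \<in> G \<rightarrow>\<^sub>M prob_algebra borel" and QG: "Q \<in> G \<rightarrow>\<^sub>M prob_algebra borel"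
    using P Q by (auto simp: regular_cond_distr_def)
  have P_prob: "prob_space (P \<omega>)" "sets (P \<omega>) = sets borel" if "\<omega> \<in> space M" for \<omega>
    using measurable_space[OF PG, of \<omega>] that by (auto simp: space_prob_algebra spG)
  have Q_prob: "prob_space (Q \<omega>)" "sets (Q \<omega>) = sets borel" if "\<omega> \<in> space M" for \<omega>
    using measurable_space[OF QG, of \<omega>] that by (auto simp: space_prob_algebra spG)
  note pX = measurable_pair_subalgebra[OF G X] and pS = measurable_pair_subalgebra[OF G S]
  have v_section[measurable]: "(\<lambda>x. v (\<omega>, x)) \<in> borel_measurable (Q \<omega>)" if "\<omega> \<in> space M" for \<omega>
    using measurable_compose[OF measurable_Pair1'[of \<omega> G borel] v] that Q_prob(2)[OF that]
    by (simp add: spG cong: measurable_cong_sets)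
  have ray: "AE \<omega> in M. emeasure (P \<omega>) B = (\<integral>\<^sup>+x. v (\<omega>, x) * indicator B x \<partial>Q \<omega>)"
    if B[measurable]: "B \<in> sets borel" for B
  proof (rule AE_restr_to_subalg[OF G], rule MG.density_unique_finite_measure)
    have PB'[measurable]: "(\<lambda>\<omega>. emeasure (P \<omega>) B) \<in> borel_measurable G"
      using measurable_compose[OF measurable_prob_algebraD[OF PG] measurable_emeasure_subprob_algebra[OF B]] .
    then show "(\<lambda>\<omega>. emeasure (P \<omega>) B) \<in> borel_measurable ?MG"
      by (rule measurable_in_subalg[OF G])
    have QB'[measurable]: "(\<lambda>\<omega>. \<integral>\<^sup>+x. v (\<omega>, x) * indicator B x \<partial>Q \<omega>) \<in> borel_measurable G"
      by (rule nn_integral_measurable_subprob_algebra2[OF _ measurable_prob_algebraD[OF QG]]) measurable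
    then show "(\<lambda>\<omega>. \<integral>\<^sup>+x. v (\<omega>, x) * indicator B x \<partial>Q \<omega>) \<in> borel_measurable ?MG"
      by (rule measurable_in_subalg[OF G])
    fix A assume "A \<in> sets ?MG"
    then have A[measurable]: "A \<in> sets G" by (simp add: sets_restr_to_subalg[OF G])
    have u: "(indicator (A \<times> B) :: _ \<Rightarrow> ennreal) \<in> borel_measurable (G \<Otimes>\<^sub>M borel)" by measurable
    have "(\<integral>\<^sup>+\<omega>. emeasure (P \<omega>) B * indicator A \<omega> \<partial>?MG)
        = (\<integral>\<^sup>+\<omega>. emeasure (P \<omega>) B * indicator A \<omega> \<partial>M)"
      by (rule nn_integral_subalgebra2[OF G]) measurable
    also have "\<dots> = (\<integral>\<^sup>+\<omega>. \<integral>\<^sup>+x. indicator (A \<times> B) (\<omega>, x) \<partial>P \<omega> \<partial>M)"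
    proof (rule nn_integral_cong)
      fix \<omega> assume w: "\<omega> \<in> space M"
      have "(\<integral>\<^sup>+x. indicator (A \<times> B) (\<omega>, x) \<partial>P \<omega>) = (\<integral>\<^sup>+x. indicator A \<omega> * indicator B x \<partial>P \<omega>)"
        by (intro nn_integral_cong) (auto simp: indicator_def)
      then show "emeasure (P \<omega>) B * indicator A \<omega> = (\<integral>\<^sup>+x. indicator (A \<times> B) (\<omega>, x) \<partial>P \<omega>)"
        using P_prob(2)[OF w] B by (simp add: nn_integral_cmult_indicator mult.commute)
    qed
    also have "\<dots> = (\<integral>\<^sup>+\<omega>. indicator (A \<times> B) (\<omega>, X \<omega>) \<partial>M)"
      by (rule nn_integral_disintegrate[OF G X P u, symmetric])
    also have "\<dots> = (\<integral>\<^sup>+p. indicator (A \<times> B) p \<partial>distr M (G \<Otimes>\<^sub>M borel) (\<lambda>\<omega>. (\<omega>, X \<omega>)))"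
      by (rule nn_integral_distr[OF pX, symmetric]) simp
    also have "\<dots> = (\<integral>\<^sup>+p. v p * indicator (A \<times> B) p \<partial>distr M (G \<Otimes>\<^sub>M borel) (\<lambda>\<omega>. (\<omega>, S \<omega>)))"
      unfolding dens[symmetric] by (rule nn_integral_density) simp_all
    also have "\<dots> = (\<integral>\<^sup>+\<omega>. v (\<omega>, S \<omega>) * indicator (A \<times> B) (\<omega>, S \<omega>) \<partial>M)"
      by (rule nn_integral_distr[OF pS]) simp
    also have "\<dots> = (\<integral>\<^sup>+\<omega>. \<integral>\<^sup>+x. v (\<omega>, x) * indicator (A \<times> B) (\<omega>, x) \<partial>Q \<omega> \<partial>M)"
      by (rule nn_integral_disintegrate[OF G S Q, of "\<lambda>p. v p * indicator (A \<times> B) p"]) simp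
    also have "\<dots> = (\<integral>\<^sup>+\<omega>. (\<integral>\<^sup>+x. v (\<omega>, x) * indicator B x \<partial>Q \<omega>) * indicator A \<omega> \<partial>M)"
      by (intro nn_integral_cong) (auto simp: indicator_def intro!: nn_integral_cong)
    also have "\<dots> = (\<integral>\<^sup>+\<omega>. (\<integral>\<^sup>+x. v (\<omega>, x) * indicator B x \<partial>Q \<omega>) * indicator A \<omega> \<partial>?MG)"
      by (rule nn_integral_subalgebra2[OF G, symmetric]) measurable
    finally show "(\<integral>\<^sup>+\<omega>. emeasure (P \<omega>) B * indicator A \<omega> \<partial>?MG)
      = (\<integral>\<^sup>+\<omega>. (\<integral>\<^sup>+x. v (\<omega>, x) * indicator B x \<partial>Q \<omega>) * indicator A \<omega> \<partial>?MG)" .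
  qed simp_all
  have "AE \<omega> in M. \<forall>q::rat.
      emeasure (P \<omega>) {of_rat q<..} = (\<integral>\<^sup>+x. v (\<omega>, x) * indicator {of_rat q<..} x \<partial>Q \<omega>)"
    unfolding AE_all_countable by (intro allI ray) simp
  with AE_space show ?thesis
  proof eventually_elim
    case (elim \<omega>)
    note w = elim(1)
    show ?case
    proof (rule real_measure_eqI_rational_rays)
      show "finite_measure (P \<omega>)" using P_prob(1)[OF w] by (rule prob_space.finite_measure)
      show "emeasure (P \<omega>) {of_rat q<..} = emeasure (density (Q \<omega>) (\<lambda>x. v (\<omega>, x))) {of_rat q<..}" for q
        using elim(2) by (subst emeasure_density) (auto simp: v_section[OF w] Q_prob(2)[OF w])
    qed (use P_prob(2)[OF w] Q_prob(2)[OF w] in auto)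
  qed
qed

text \<open>
  Radon--Nikodym derivatives with respect to a probability measure are almost everywhere unique, so
  the density obtained from the joint laws can replace the pointwise choice of \<open>RN_deriv\<close>.
\<close>

lemma (in prob_space) RN_version_iff_AE_eq:
  assumes G: "subalgebra M G" and Q: "regular_cond_distr M G S Q"
    and v: "v \<in> borel_measurable (G \<Otimes>\<^sub>M borel)"
    and dens: "AE \<omega> in M. P \<omega> = density (Q \<omega>) (\<lambda>x. v (\<omega>, x))"
  shows "RN_version M G Q P D \<longleftrightarrow>
    (\<lambda>(\<omega>, x). D \<omega> x) \<in> borel_measurable (G \<Otimes>\<^sub>M borel) \<and>
    (AE \<omega> in M. AE x in Q \<omega>. D \<omega> x = v (\<omega>, x))"
proof -
  have QG: "Q \<in> G \<rightarrow>\<^sub>M prob_algebra borel"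
    using Q by (auto simp: regular_cond_distr_def)
  have spG: "space G = space M" using G by (simp add: subalgebra_def)
  have RN: "AE \<omega> in M. AE x in Q \<omega>. v (\<omega>, x) = RN_deriv (Q \<omega>) (P \<omega>) x"
    using dens AE_space
  proof eventually_elim
    case (elim \<omega>)
    have Q_prob: "prob_space (Q \<omega>)" "sets (Q \<omega>) = sets borel"
      using measurable_space[OF QG, of \<omega>] elim(2) by (auto simp: space_prob_algebra spG)
    interpret Q\<omega>: prob_space "Q \<omega>" by (rule Q_prob)
    have "(\<lambda>x. v (\<omega>, x)) \<in> borel_measurable (Q \<omega>)"
      using measurable_compose[OF measurable_Pair1'[of \<omega> G borel] v] elim(2) Q_prob(2)
      by (simp add: spG cong: measurable_cong_sets)
    then show ?case
      by (rule Q\<omega>.RN_deriv_unique) (rule elim(1)[symmetric])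
  qed
  have "(AE \<omega> in M. AE x in Q \<omega>. D \<omega> x = RN_deriv (Q \<omega>) (P \<omega>) x) \<longleftrightarrow>
      (AE \<omega> in M. AE x in Q \<omega>. D \<omega> x = v (\<omega>, x))"
  proof
    assume "AE \<omega> in M. AE x in Q \<omega>. D \<omega> x = RN_deriv (Q \<omega>) (P \<omega>) x"
    with RN show "AE \<omega> in M. AE x in Q \<omega>. D \<omega> x = v (\<omega>, x)"
      by (auto elim!: eventually_elim2)
  next
    assume "AE \<omega> in M. AE x in Q \<omega>. D \<omega> x = v (\<omega>, x)"
    with RN show "AE \<omega> in M. AE x in Q \<omega>. D \<omega> x = RN_deriv (Q \<omega>) (P \<omega>) x"
      by (auto elim!: eventually_elim2)
  qed
  then show ?thesis
    unfolding RN_version_def by simp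
qed

text \<open>
  Let \<open>N\<close> be the set where \<open>u\<close> and \<open>v\<close> differ. The probability that \<open>(\<omega>, S \<omega>) \<in> N\<close> is the mean of the
  \<open>Q \<omega>\<close>-masses of the sections of \<open>N\<close>, all but a null set of which vanish.
\<close>

lemma (in prob_space) AE_eq_at_random_point:
  fixes u v :: "'a \<times> real \<Rightarrow> ennreal"
  assumes G: "subalgebra M G" and S[measurable]: "S \<in> borel_measurable M"
    and Q: "regular_cond_distr M G S Q"
    and [measurable]: "u \<in> borel_measurable (G \<Otimes>\<^sub>M borel)" "v \<in> borel_measurable (G \<Otimes>\<^sub>M borel)"
    and eq: "AE \<omega> in M. AE x in Q \<omega>. u (\<omega>, x) = v (\<omega>, x)"
  shows "AE \<omega> in M. u (\<omega>, S \<omega>) = v (\<omega>, S \<omega>)"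
proof -
  let ?N = "{p \<in> space (G \<Otimes>\<^sub>M borel). u p \<noteq> v p}"
  have pS[measurable]: "(\<lambda>\<omega>. (\<omega>, S \<omega>)) \<in> M \<rightarrow>\<^sub>M G \<Otimes>\<^sub>M borel"
    by (rule measurable_pair_subalgebra[OF G S])
  have N[measurable]: "?N \<in> sets (G \<Otimes>\<^sub>M borel)" by measurable
  have "(\<integral>\<^sup>+\<omega>. indicator ?N (\<omega>, S \<omega>) \<partial>M) = (\<integral>\<^sup>+\<omega>. \<integral>\<^sup>+x. indicator ?N (\<omega>, x) \<partial>Q \<omega> \<partial>M)"
    by (rule nn_integral_disintegrate[OF G S Q]) simp
  also have "\<dots> = (\<integral>\<^sup>+\<omega>. 0 \<partial>M)"
  proof (rule nn_integral_cong_AE, use eq in eventually_elim)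
    case (elim \<omega>)
    have "(\<integral>\<^sup>+x. indicator ?N (\<omega>, x) \<partial>Q \<omega>) = (\<integral>\<^sup>+x. 0 \<partial>Q \<omega>)"
      by (rule nn_integral_cong_AE, use elim in eventually_elim) simp
    then show ?case by simp
  qed
  finally have "(\<integral>\<^sup>+\<omega>. indicator ?N (\<omega>, S \<omega>) \<partial>M) = 0" by simp
  then have "AE \<omega> in M. indicator ?N (\<omega>, S \<omega>) = (0::ennreal)"
    by (subst (asm) nn_integral_0_iff_AE) auto
  with AE_space show ?thesis
    by eventually_elim
      (use measurable_space[OF pS] in \<open>auto simp: indicator_def split: if_splits\<close>)
qed

section \<open>Weights as likelihood ratios\<close>

lemma (in prob_space) targets_integrable:
  assumes T: "targets M G X S W"
  shows "integrable M W"
proof -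
  have one: "(\<lambda>_. 1 :: real) \<in> borel_measurable (borel :: real measure)" by simp
  have int: "integrable M (\<lambda>_. 1 :: real)" by simp
  from T[unfolded targets_def, THEN bspec, OF one, THEN mp, OF int]
  have "integrable M (\<lambda>\<omega>. W \<omega> * 1)" by (rule conjunct1)
  then show ?thesis by simp
qed

text \<open>
  On a rectangle \<open>A \<times> B\<close> this is the targeting condition for \<open>\<phi> = indicator B\<close>, integrated over \<open>A\<close>. Both
  sides are countably additive in \<open>C\<close>, the right one as a signed measure since \<open>W\<close> is integrable but
  may be negative; the class of sets on which they agree is therefore a Dynkin system.
\<close>

lemma (in prob_space) targets_joint_law:
  assumes G: "subalgebra M G"
    and X[measurable]: "X \<in> borel_measurable M" and S[measurable]: "S \<in> borel_measurable M"
    and T: "targets M G X S W"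
    and C: "C \<in> sets (G \<Otimes>\<^sub>M borel)"
  shows "measure M ((\<lambda>\<omega>. (\<omega>, X \<omega>)) -` C \<inter> space M) =
    (\<integral>\<omega>\<in>(\<lambda>\<omega>. (\<omega>, S \<omega>)) -` C \<inter> space M. W \<omega> \<partial>M)"
proof -
  interpret G: finite_measure_subalgebra M G
    by unfold_locales (rule G)
  note W = targets_integrable[OF T]
  note [measurable] = borel_measurable_integrable[OF W]
  let ?X = "\<lambda>C. (\<lambda>\<omega>. (\<omega>, X \<omega>)) -` C \<inter> space M" and ?S = "\<lambda>C. (\<lambda>\<omega>. (\<omega>, S \<omega>)) -` C \<inter> space M"
  let ?\<Omega> = "space G \<times> space (borel :: real measure)"
  have spG: "space G = space M" using G by (simp add: subalgebra_def)
  have XM: "?X C \<in> sets M" and SM: "?S C \<in> sets M" if "C \<in> sets (G \<Otimes>\<^sub>M borel)" for C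
    using measurable_sets[OF measurable_pair_subalgebra[OF G X] that]
      measurable_sets[OF measurable_pair_subalgebra[OF G S] that] .
  have int: "set_integrable M A W" if "A \<in> sets M" for A
    using integrable_mult_indicator[OF that W] by (simp add: set_integrable_def)
  let ?E = "{A \<times> B | A B. A \<in> sets G \<and> B \<in> sets (borel :: real measure)}"
  have rect: "measure M (?X (A \<times> B)) = (\<integral>\<omega>\<in>?S (A \<times> B). W \<omega> \<partial>M)"
    if A: "A \<in> sets G" and B[measurable]: "B \<in> sets borel" for A B
  proof -
    have AM[measurable]: "A \<in> sets M" using A G by (auto simp: subalgebra_def)
    have intX: "integrable M (\<lambda>\<omega>. indicator B (X \<omega>) :: real)"
      by (rule integrable_const_bound[of _ 1]) auto
    have "(indicator B :: real \<Rightarrow> real) \<in> borel_measurable borel" by simp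
    note T' = T[unfolded targets_def, THEN bspec, OF this, THEN mp, OF intX]
    from T' have intS: "integrable M (\<lambda>\<omega>. W \<omega> * indicator B (S \<omega>))"
      and cond: "AE \<omega> in M. real_cond_exp M G (\<lambda>\<omega>. W \<omega> * indicator B (S \<omega>)) \<omega> =
        real_cond_exp M G (\<lambda>\<omega>. indicator B (X \<omega>)) \<omega>"
      by (rule conjunct1, rule conjunct2)
    have "measure M (?X (A \<times> B)) = (\<integral>\<omega>. indicator (?X (A \<times> B)) \<omega> \<partial>M)"
      using XM[of "A \<times> B"] A B by simp
    also have "\<dots> = (\<integral>\<omega>\<in>A. indicator B (X \<omega>) \<partial>M)"
      unfolding set_lebesgue_integral_def
      by (intro Bochner_Integration.integral_cong) (auto simp: indicator_def)
    also have "\<dots> = (\<integral>\<omega>\<in>A. real_cond_exp M G (\<lambda>\<omega>. indicator B (X \<omega>)) \<omega> \<partial>M)"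
      by (rule G.real_cond_exp_intA[OF intX A])
    also have "\<dots> = (\<integral>\<omega>\<in>A. real_cond_exp M G (\<lambda>\<omega>. W \<omega> * indicator B (S \<omega>)) \<omega> \<partial>M)"
      by (intro set_lebesgue_integral_cong_AE) (use cond in auto)
    also have "\<dots> = (\<integral>\<omega>\<in>A. W \<omega> * indicator B (S \<omega>) \<partial>M)"
      by (rule G.real_cond_exp_intA[OF intS A, symmetric])
    also have "\<dots> = (\<integral>\<omega>\<in>?S (A \<times> B). W \<omega> \<partial>M)"
      unfolding set_lebesgue_integral_def
      by (intro Bochner_Integration.integral_cong) (auto simp: indicator_def)
    finally show ?thesis .
  qed
  have EPow: "?E \<subseteq> Pow ?\<Omega>" using sets.sets_into_space by auto
  have gen: "sets (G \<Otimes>\<^sub>M borel) = sigma_sets ?\<Omega> ?E" by (simp add: sets_pair_measure)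
  \<comment> \<open>The mean of \<open>W\<close> is one; complements in the Dynkin system need this normalisation.\<close>
  have total: "1 = (\<integral>\<omega>\<in>space M. W \<omega> \<partial>M)"
  proof -
    have "?X ?\<Omega> = space M" "?S ?\<Omega> = space M" by (auto simp: spG)
    with rect[of "space G" "space borel"] show ?thesis by (simp add: prob_space)
  qed
  from C[unfolded gen] show ?thesis
  proof (induct rule: sigma_sets_induct_disjoint[OF Int_stable_pair_measure_generator EPow, consumes 1, case_names basic empty compl union])
    case (basic C)
    then show ?case using rect by auto
  next
    case empty
    show ?case by (simp add: set_lebesgue_integral_def)
  next
    case (compl C)
    then have C: "C \<in> sets (G \<Otimes>\<^sub>M borel)" by (simp add: gen)
    have eq: "?X (?\<Omega> - C) = space M - ?X C" "?S (?\<Omega> - C) = space M - ?S C"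
      by (auto simp: spG)
    have "(\<integral>\<omega>\<in>space M. W \<omega> \<partial>M) = (\<integral>\<omega>\<in>?S C \<union> (space M - ?S C). W \<omega> \<partial>M)"
      by (intro arg_cong[of _ _ "\<lambda>A. \<integral>\<omega>\<in>A. W \<omega> \<partial>M"]) auto
    also have "\<dots> = (\<integral>\<omega>\<in>?S C. W \<omega> \<partial>M) + (\<integral>\<omega>\<in>space M - ?S C. W \<omega> \<partial>M)"
      by (rule set_integral_Un) (use SM[OF C] in \<open>auto intro!: int\<close>)
    finally show ?case
      unfolding eq prob_compl[OF XM[OF C]] using compl total by simp
  next
    case (union A)
    then have A: "A i \<in> sets (G \<Otimes>\<^sub>M borel)" for i by (auto simp: gen)
    have eq: "?X (\<Union>i. A i) = (\<Union>i. ?X (A i))" "?S (\<Union>i. A i) = (\<Union>i. ?S (A i))" by auto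
    have "measure M (\<Union>i. ?X (A i)) = (\<Sum>i. measure M (?X (A i)))"
      using union(1) XM[OF A]
      by (intro sums_unique finite_measure_UNION) (auto simp: disjoint_family_on_def)
    also have "\<dots> = (\<Sum>i. \<integral>\<omega>\<in>?S (A i). W \<omega> \<partial>M)"
      using union(3) by simp
    also have "\<dots> = (\<integral>\<omega>\<in>(\<Union>i. ?S (A i)). W \<omega> \<partial>M)"
      using union(1) SM[OF A] sets.countable_UN[of "\<lambda>i. ?S (A i)" UNIV M]
      by (intro lebesgue_integral_countable_add[symmetric] int)
        (auto simp: disjoint_family_on_def simp del: UN_simps)
    finally show ?case unfolding eq .
  qed
qed

text \<open>
  The integral of \<open>W\<close> over a null event is zero, so the law of \<open>(\<omega>, X \<omega>)\<close> is absolutely continuous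
  with respect to that of \<open>(\<omega>, S \<omega>)\<close>. Passing through the product space gives one jointly
  measurable density instead of unrelated densities for the individual \<open>\<omega>\<close>.
\<close>

lemma (in prob_space) targets_joint_density:
  assumes G: "subalgebra M G"
    and X[measurable]: "X \<in> borel_measurable M" and S[measurable]: "S \<in> borel_measurable M"
    and T: "targets M G X S W"
  obtains v where "v \<in> borel_measurable (G \<Otimes>\<^sub>M borel)"
    and "density (distr M (G \<Otimes>\<^sub>M borel) (\<lambda>\<omega>. (\<omega>, S \<omega>))) v =
      distr M (G \<Otimes>\<^sub>M borel) (\<lambda>\<omega>. (\<omega>, X \<omega>))"
proof -
  note pX = measurable_pair_subalgebra[OF G X] and pS = measurable_pair_subalgebra[OF G S]
  interpret S: prob_space "distr M (G \<Otimes>\<^sub>M borel) (\<lambda>\<omega>. (\<omega>, S \<omega>))"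
    by (rule prob_space_distr[OF pS])
  have "absolutely_continuous (distr M (G \<Otimes>\<^sub>M borel) (\<lambda>\<omega>. (\<omega>, S \<omega>)))
    (distr M (G \<Otimes>\<^sub>M borel) (\<lambda>\<omega>. (\<omega>, X \<omega>)))"
    unfolding absolutely_continuous_def
  proof
    fix C assume "C \<in> null_sets (distr M (G \<Otimes>\<^sub>M borel) (\<lambda>\<omega>. (\<omega>, S \<omega>)))"
    then have C: "C \<in> sets (G \<Otimes>\<^sub>M borel)"
      and null: "(\<lambda>\<omega>. (\<omega>, S \<omega>)) -` C \<inter> space M \<in> null_sets M"
      using null_sets_distr_iff[OF pS, of C] by auto
    have "AE \<omega> in M. indicator ((\<lambda>\<omega>. (\<omega>, S \<omega>)) -` C \<inter> space M) \<omega> *\<^sub>R W \<omega> = 0"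
      using AE_not_in[OF null] by eventually_elim simp
    then have "(\<integral>\<omega>\<in>(\<lambda>\<omega>. (\<omega>, S \<omega>)) -` C \<inter> space M. W \<omega> \<partial>M) = 0"
      unfolding set_lebesgue_integral_def by (rule integral_eq_zero_AE)
    then have "emeasure M ((\<lambda>\<omega>. (\<omega>, X \<omega>)) -` C \<inter> space M) = 0"
      using targets_joint_law[OF G X S T C] by (simp add: emeasure_eq_measure)
    then show "C \<in> null_sets (distr M (G \<Otimes>\<^sub>M borel) (\<lambda>\<omega>. (\<omega>, X \<omega>)))"
      using C by (auto simp: null_sets_def emeasure_distr[OF pX C])
  qed
  from S.Radon_Nikodym[OF this] that show ?thesis by auto
qed

text \<open>
  An event of the join is \<open>(\<omega>, S \<omega>) \<in> C\<close> for some \<open>C\<close>, and the integrals over it of \<open>W\<close> and of the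
  density at \<open>(\<omega>, S \<omega>)\<close> both equal the probability that \<open>(\<omega>, X \<omega>) \<in> C\<close>.
\<close>

lemma (in prob_space) targets_cond_exp_weight:
  assumes G: "subalgebra M G"
    and X[measurable]: "X \<in> borel_measurable M" and S[measurable]: "S \<in> borel_measurable M"
    and T: "targets M G X S W"
    and v[measurable]: "v \<in> borel_measurable (G \<Otimes>\<^sub>M borel)"
    and dens: "density (distr M (G \<Otimes>\<^sub>M borel) (\<lambda>\<omega>. (\<omega>, S \<omega>))) v =
      distr M (G \<Otimes>\<^sub>M borel) (\<lambda>\<omega>. (\<omega>, X \<omega>))"
  shows "integrable M (\<lambda>\<omega>. enn2real (v (\<omega>, S \<omega>)))"
    and "AE \<omega> in M. real_cond_exp M (join_sigma M G S) W \<omega> = enn2real (v (\<omega>, S \<omega>))"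
proof -
  have spG: "space G = space M" using G by (simp add: subalgebra_def)
  let ?H = "join_sigma M G S" and ?R = "\<lambda>\<omega>. enn2real (v (\<omega>, S \<omega>))"
  have H: "subalgebra M ?H" by (rule subalgebra_join_sigma[OF G refl S])
  interpret H: finite_measure_subalgebra M ?H
    by unfold_locales (rule H)
  note pX = measurable_pair_subalgebra[OF G X] and pS[measurable] = measurable_pair_subalgebra[OF G S]
  have mass: "(\<integral>\<^sup>+\<omega>. v (\<omega>, S \<omega>) * indicator C (\<omega>, S \<omega>) \<partial>M) =
      emeasure M ((\<lambda>\<omega>. (\<omega>, X \<omega>)) -` C \<inter> space M)"
    if C[measurable]: "C \<in> sets (G \<Otimes>\<^sub>M borel)" for C
  proof -
    have "(\<integral>\<^sup>+\<omega>. v (\<omega>, S \<omega>) * indicator C (\<omega>, S \<omega>) \<partial>M)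
        = (\<integral>\<^sup>+p. v p * indicator C p \<partial>distr M (G \<Otimes>\<^sub>M borel) (\<lambda>\<omega>. (\<omega>, S \<omega>)))"
      by (rule nn_integral_distr[OF pS, symmetric]) simp
    also have "\<dots> = emeasure (distr M (G \<Otimes>\<^sub>M borel) (\<lambda>\<omega>. (\<omega>, X \<omega>))) C"
      unfolding dens[symmetric] by (rule emeasure_density[symmetric]) simp_all
    also have "\<dots> = emeasure M ((\<lambda>\<omega>. (\<omega>, X \<omega>)) -` C \<inter> space M)"
      by (rule emeasure_distr[OF pX C])
    finally show ?thesis .
  qed
  have total: "(\<integral>\<^sup>+\<omega>. v (\<omega>, S \<omega>) \<partial>M) = 1"
  proof -
    have "(\<lambda>\<omega>. (\<omega>, X \<omega>)) -` space (G \<Otimes>\<^sub>M borel) \<inter> space M = space M"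
      by (auto simp: space_pair_measure spG)
    moreover have "(\<integral>\<^sup>+\<omega>. v (\<omega>, S \<omega>) * indicator (space (G \<Otimes>\<^sub>M borel)) (\<omega>, S \<omega>) \<partial>M) =
        (\<integral>\<^sup>+\<omega>. v (\<omega>, S \<omega>) \<partial>M)"
      by (intro nn_integral_cong) (auto simp: space_pair_measure spG)
    ultimately show ?thesis
      using mass[OF sets.top] emeasure_space_1 by simp
  qed
  \<comment> \<open>At an infinite value \<open>enn2real\<close> would be zero; the total mass one excludes it almost surely.\<close>
  have fin: "AE \<omega> in M. v (\<omega>, S \<omega>) \<noteq> \<infinity>"
    by (rule nn_integral_PInf_AE) (simp_all add: total)
  have "(\<integral>\<^sup>+\<omega>. ennreal (?R \<omega>) \<partial>M) = (\<integral>\<^sup>+\<omega>. v (\<omega>, S \<omega>) \<partial>M)"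
    by (rule nn_integral_cong_AE, use fin in eventually_elim) (simp add: less_top)
  then show int: "integrable M ?R"
    by (intro integrableI_nonneg) (simp_all add: total)
  show "AE \<omega> in M. real_cond_exp M ?H W \<omega> = ?R \<omega>"
  proof (rule H.real_cond_exp_charact[OF _ targets_integrable[OF T] int])
    show "?R \<in> borel_measurable ?H"
      by (rule borel_measurable_enn2real[OF measurable_compose[OF measurable_join_sigma[OF spG] v]])
    fix A assume "A \<in> sets ?H"
    then obtain C where C[measurable]: "C \<in> sets (G \<Otimes>\<^sub>M borel)"
      and A: "A = (\<lambda>\<omega>. (\<omega>, S \<omega>)) -` C \<inter> space M"
      by (rule sets_join_sigmaE[OF _ spG])
    have AM: "A \<in> sets M" unfolding A by (rule measurable_sets[OF pS C])
    have "ennreal (\<integral>\<omega>\<in>A. ?R \<omega> \<partial>M) = (\<integral>\<^sup>+\<omega>. ennreal (indicator A \<omega> *\<^sub>R ?R \<omega>) \<partial>M)"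
      unfolding set_lebesgue_integral_def
      by (rule nn_integral_eq_integral[symmetric])
        (use integrable_mult_indicator[OF AM int] in auto)
    also have "\<dots> = (\<integral>\<^sup>+\<omega>. v (\<omega>, S \<omega>) * indicator C (\<omega>, S \<omega>) \<partial>M)"
      by (rule nn_integral_cong_AE, use fin AE_space in eventually_elim)
        (auto simp: A indicator_def less_top)
    also have "\<dots> = ennreal (\<integral>\<omega>\<in>A. W \<omega> \<partial>M)"
      unfolding mass[OF C] A targets_joint_law[OF G X S T C, symmetric]
      by (rule emeasure_eq_measure)
    finally have "ennreal (\<integral>\<omega>\<in>A. W \<omega> \<partial>M) = ennreal (\<integral>\<omega>\<in>A. ?R \<omega> \<partial>M)" by simp
    moreover have "0 \<le> (\<integral>\<omega>\<in>A. W \<omega> \<partial>M)"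
      unfolding A targets_joint_law[OF G X S T C, symmetric] by simp
    moreover have "0 \<le> (\<integral>\<omega>\<in>A. ?R \<omega> \<partial>M)"
      unfolding set_lebesgue_integral_def by (intro Bochner_Integration.integral_nonneg) simp
    ultimately show "(\<integral>\<omega>\<in>A. W \<omega> \<partial>M) = (\<integral>\<omega>\<in>A. ?R \<omega> \<partial>M)"
      by (simp add: ennreal_inj)
  qed
qed

section \<open>Least second moment\<close>

text \<open>
  Conditional Jensen for the square. An infinite second moment of \<open>V\<close> makes the bound trivial, so \<open>V\<^sup>2\<close>
  may be taken integrable.
\<close>

lemma (in prob_space) nn_integral_square_cond_exp_le:
  assumes H: "subalgebra M H" and V: "integrable M V"
    and R: "AE \<omega> in M. real_cond_exp M H V \<omega> = R \<omega>"
  shows "(\<integral>\<^sup>+\<omega>. ennreal ((R \<omega>)\<^sup>2) \<partial>M) \<le> (\<integral>\<^sup>+\<omega>. ennreal ((V \<omega>)\<^sup>2) \<partial>M)"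
proof (cases "(\<integral>\<^sup>+\<omega>. ennreal ((V \<omega>)\<^sup>2) \<partial>M) = \<infinity>")
  case False
  interpret H: finite_measure_subalgebra M H
    by unfold_locales (rule H)
  note [measurable] = borel_measurable_integrable[OF V]
  have V2: "integrable M (\<lambda>\<omega>. (V \<omega>)\<^sup>2)"
    using False by (intro integrableI_nonneg) (auto simp: less_top)
  have "convex_on UNIV (\<lambda>x::real. x\<^sup>2)"
    by (rule convex_power2)
  then have "AE \<omega> in M. (real_cond_exp M H V \<omega>)\<^sup>2 \<le> real_cond_exp M H (\<lambda>\<omega>. (V \<omega>)\<^sup>2) \<omega>"
    by (intro H.real_cond_exp_jensens_inequality(2)[OF V _ _ V2, where I = UNIV and a = 0 and b = 0]) simp_all
  with R have ae: "AE \<omega> in M. (R \<omega>)\<^sup>2 \<le> real_cond_exp M H (\<lambda>\<omega>. (V \<omega>)\<^sup>2) \<omega>"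
    by eventually_elim simp
  then have "(\<integral>\<^sup>+\<omega>. ennreal ((R \<omega>)\<^sup>2) \<partial>M) \<le> (\<integral>\<^sup>+\<omega>. ennreal (real_cond_exp M H (\<lambda>\<omega>. (V \<omega>)\<^sup>2) \<omega>) \<partial>M)"
    by (intro nn_integral_mono_AE) (auto intro: ennreal_leI)
  also have "\<dots> = ennreal (\<integral>\<omega>. real_cond_exp M H (\<lambda>\<omega>. (V \<omega>)\<^sup>2) \<omega> \<partial>M)"
  proof (rule nn_integral_eq_integral[OF H.real_cond_exp_int(1)[OF V2]])
    show "AE \<omega> in M. 0 \<le> real_cond_exp M H (\<lambda>\<omega>. (V \<omega>)\<^sup>2) \<omega>"
      using ae by eventually_elim (meson order_trans zero_le_power2)
  qed
  also have "\<dots> = ennreal (\<integral>\<omega>. (V \<omega>)\<^sup>2 \<partial>M)"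
    by (simp only: H.real_cond_exp_int(2)[OF V2])
  also have "\<dots> = (\<integral>\<^sup>+\<omega>. ennreal ((V \<omega>)\<^sup>2) \<partial>M)"
    by (rule nn_integral_eq_integral[OF V2, symmetric]) simp
  finally show ?thesis .
qed simp

text \<open>
  \<open>R\<close> satisfies its own constraint because it is \<open>H\<close>-measurable; every other admissible weight has
  conditional expectation \<open>R\<close> and hence at least the second moment of \<open>R\<close>.
\<close>

lemma (in prob_space) is_arg_min_square_admissible_weight:
  assumes G: "subalgebra M G" and H: "subalgebra G H"
    and R: "integrable M R" "R \<in> borel_measurable H"
  shows "is_arg_min (\<lambda>V. \<integral>\<^sup>+\<omega>. ennreal ((V \<omega>)\<^sup>2) \<partial>M) (admissible_weight M G H R) R"
proof -
  have HM: "subalgebra M H" using G H by (auto simp: subalgebra_def)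
  interpret H: finite_measure_subalgebra M H
    by unfold_locales (rule HM)
  have "admissible_weight M G H R R"
    using measurable_from_subalg[OF H R(2)] R(1) H.real_cond_exp_F_meas[OF R]
    by (simp add: admissible_weight_def)
  then show ?thesis
    unfolding is_arg_min_linorder
    by (auto simp: admissible_weight_def intro: nn_integral_square_cond_exp_le[OF HM])
qed

theorem theorem2:
  fixes M :: "'a measure" and F :: "real \<Rightarrow> 'a measure"
    and f g h :: "real \<Rightarrow> real \<Rightarrow> real" and P0 :: "real measure"
    and BX BY X Y S W :: "real \<Rightarrow> 'a \<Rightarrow> real"
    and t :: real and P Q :: "'a \<Rightarrow> real measure"
  defines "FY \<equiv> observation_sigma M Y t"
  defines "FYS \<equiv> join_sigma M FY (S t)"
  assumes "filtering_problem M F f g h P0 BX BY X Y"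
    and "progressive F S" and "progressive F W"
    and "0 \<le> t"
    and "regular_cond_distr M FY (X t) P"
    and "regular_cond_distr M FY (S t) Q"
    and "targets M FY (X t) (S t) (W t)"
  shows "(AE \<omega> in M. absolutely_continuous (Q \<omega>) (P \<omega>)) \<and>
    (\<exists>D. RN_version M FY Q P D) \<and>
    (\<forall>D. RN_version M FY Q P D \<longrightarrow>
       (let Wstar = (\<lambda>\<omega>. enn2real (D \<omega> (S t \<omega>))) in
         (AE \<omega> in M. real_cond_exp M FYS (W t) \<omega> = Wstar \<omega>) \<and>
         is_arg_min (\<lambda>V. \<integral>\<^sup>+\<omega>. ennreal ((V \<omega>)\<^sup>2) \<partial>M) (admissible_weight M (F t) FYS Wstar) Wstar))"
proof -
  have t: "0 \<le> t" and S_prog: "progressive F S"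
    and P: "regular_cond_distr M FY (X t) P" and Q: "regular_cond_distr M FY (S t) Q"
    and T: "targets M FY (X t) (S t) (W t)"
    by fact+
  interpret filtering_problem M F f g h P0 BX BY X Y by fact
  have F: "subalgebra M (F s)" if "0 \<le> s" for s
    using usual[unfolded usual_filtration_def, THEN conjunct1] that by simp
  have F_mono: "sets (F s) \<subseteq> sets (F t)" if "0 \<le> s" "s \<le> t" for s
    using usual[unfolded usual_filtration_def, THEN conjunct2, THEN conjunct1] that by simp
  note Ft = F[OF t]
  have spF: "space (F s) = space M" if "0 \<le> s" for s
    using F[OF that] by (simp add: subalgebra_def)
  have X_prog: "progressive F X" using X_sde by (simp add: sde_solution_def)
  have SFt: "S t \<in> borel_measurable (F t)"
    by (rule progressive_adapted[OF S_prog t])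
  have S: "S t \<in> borel_measurable M"
    by (rule measurable_from_subalg[OF Ft SFt])
  have X: "X t \<in> borel_measurable M"
    by (rule measurable_from_subalg[OF Ft progressive_adapted[OF X_prog t]])
  have YFt: "Y s \<in> borel_measurable (F t)" if "0 \<le> s" "s \<le> t" for s
    by (rule measurable_from_subalg[OF _ progressive_adapted[OF Y_progressive that(1)]])
      (use F_mono[OF that] spF that t in \<open>auto simp: subalgebra_def\<close>)
  have FY_Ft: "subalgebra (F t) FY"
    unfolding FY_def by (rule subalgebra_observation_sigma) (use YFt spF t in auto)
  then have FY: "subalgebra M FY"
    using Ft by (auto simp: subalgebra_def)
  have FYS_Ft: "subalgebra (F t) FYS"
    unfolding FYS_def by (rule subalgebra_join_sigma[OF FY_Ft spF[OF t] SFt])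
  then have FYS: "subalgebra M FYS"
    using Ft by (auto simp: subalgebra_def)
  have spFY: "space FY = space M" using FY by (simp add: subalgebra_def)
  obtain v where v: "v \<in> borel_measurable (FY \<Otimes>\<^sub>M borel)"
    and dens: "density (distr M (FY \<Otimes>\<^sub>M borel) (\<lambda>\<omega>. (\<omega>, S t \<omega>))) v =
      distr M (FY \<Otimes>\<^sub>M borel) (\<lambda>\<omega>. (\<omega>, X t \<omega>))"
    by (rule targets_joint_density[OF FY X S T])
  have PQ: "AE \<omega> in M. P \<omega> = density (Q \<omega>) (\<lambda>x. v (\<omega>, x))"
    by (rule AE_regular_cond_distr_eq_density[OF FY X S P Q v dens])
  have RN_iff: "RN_version M FY Q P D \<longleftrightarrow>
      (\<lambda>(\<omega>, x). D \<omega> x) \<in> borel_measurable (FY \<Otimes>\<^sub>M borel) \<and>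
      (AE \<omega> in M. AE x in Q \<omega>. D \<omega> x = v (\<omega>, x))" for D
    by (rule RN_version_iff_AE_eq[OF FY Q v PQ])
  have ac: "AE \<omega> in M. absolutely_continuous (Q \<omega>) (P \<omega>)"
    using PQ AE_space
  proof eventually_elim
    case (elim \<omega>)
    have "sets (Q \<omega>) = sets borel"
      using Q measurable_space[of Q FY "prob_algebra borel" \<omega>] elim(2)
      by (auto simp: regular_cond_distr_def space_prob_algebra spFY)
    then have "(\<lambda>x. v (\<omega>, x)) \<in> borel_measurable (Q \<omega>)"
      using measurable_compose[OF measurable_Pair1'[of \<omega> FY borel] v] elim(2)
      by (simp add: spFY cong: measurable_cong_sets)
    then show ?case
      unfolding elim(1) by (rule absolutely_continuousI_density)
  qed
  have "RN_version M FY Q P (\<lambda>\<omega> x. v (\<omega>, x))"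
    unfolding RN_iff using v by simp
  moreover have "(AE \<omega> in M. real_cond_exp M FYS (W t) \<omega> = enn2real (D \<omega> (S t \<omega>))) \<and>
      is_arg_min (\<lambda>V. \<integral>\<^sup>+\<omega>. ennreal ((V \<omega>)\<^sup>2) \<partial>M)
        (admissible_weight M (F t) FYS (\<lambda>\<omega>. enn2real (D \<omega> (S t \<omega>)))) (\<lambda>\<omega>. enn2real (D \<omega> (S t \<omega>)))"
    if "RN_version M FY Q P D" for D
  proof -
    let ?R = "\<lambda>\<omega>. enn2real (D \<omega> (S t \<omega>))"
    have D: "(\<lambda>(\<omega>, x). D \<omega> x) \<in> borel_measurable (FY \<Otimes>\<^sub>M borel)"
      and Dv: "AE \<omega> in M. AE x in Q \<omega>. D \<omega> x = v (\<omega>, x)"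
      using that unfolding RN_iff by auto
    have DSv: "AE \<omega> in M. D \<omega> (S t \<omega>) = v (\<omega>, S t \<omega>)"
      using AE_eq_at_random_point[OF FY S Q D v] Dv by simp
    have R_FYS: "?R \<in> borel_measurable FYS"
      using borel_measurable_enn2real[OF measurable_compose[OF measurable_join_sigma[OF spFY] D]]
      by (simp only: FYS_def split_conv)
    have R_M: "?R \<in> borel_measurable M" by (rule measurable_from_subalg[OF FYS R_FYS])
    have vint: "integrable M (\<lambda>\<omega>. enn2real (v (\<omega>, S t \<omega>)))"
      and vcond: "AE \<omega> in M. real_cond_exp M FYS (W t) \<omega> = enn2real (v (\<omega>, S t \<omega>))"
      using targets_cond_exp_weight[OF FY X S T v dens] unfolding FYS_def by auto
    have R_int: "integrable M ?R"
      by (rule integrable_cong_AE_imp[OF vint R_M]) (use DSv in eventually_elim, simp)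
    have cond: "AE \<omega> in M. real_cond_exp M FYS (W t) \<omega> = ?R \<omega>"
      using vcond DSv by eventually_elim simp
    have "is_arg_min (\<lambda>V. \<integral>\<^sup>+\<omega>. ennreal ((V \<omega>)\<^sup>2) \<partial>M) (admissible_weight M (F t) FYS ?R) ?R"
      by (rule is_arg_min_square_admissible_weight[OF Ft FYS_Ft R_int R_FYS])
    with cond show ?thesis by blast
  qed
  ultimately show ?thesis
    using ac unfolding Let_def by blast
qed

end
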